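(* Let $A$ be an algebra, $\sigma : A \to A$ an algebra automorphism, $\delta : A \to A$ a $\sigma$-derivation, and $\tau : A \to \mathbb{C}$ a $\sigma$-trace. If $\tau \circ \delta = 0$, then the linear functional $\mathrm{res} : \Psi(A,\sigma,\delta) \to \mathbb{C}$ on the algebra of formal twisted pseudodifferential symbols defined by $$\mathrm{res}\Big(\sum_{i=-\infty}^{n} a_i \xi^i\Big) = \tau(a_{-1})$$ is a trace, i.e. $\mathrm{res}(D_1D_2)=\mathrm{res}(D_2D_1)$ for all $D_1,D_2\in\Psi(A,\sigma,\delta)$.
   Context: Algebras are associative, unital, not necessarily commutative, over $\mathbb{C}$. A $\sigma$-derivation on $A$ is a linear map $\delta:A\to A$ with $\delta(ab)=\delta(a)b+\sigma(a)\delta(b)$ for all $a,b\in A$. A $\sigma$-trace on $A$ is a linear map $\tau:A\to\mathbb{C}$ with $\tau(ab)=\tau(\sigma(b)a)$ for all $a,b\in A$. The algebra of formal twisted pseudodifferential symbols $\Psi(A,\sigma,\delta)$ is the set of all formal series $\sum_{n=-\infty}^{N} a_n\xi^n$ with $N\in\mathbb{Z}$, $a_n\in A$. It is an associative unital algebra, with multiplication determined by the relations $\xi a-\sigma(a)\xi=\delta(a)$ for $a \in A$ and $\xi\xi^{-1}=\xi^{-1}\xi=1$. Explicitly, for $n\ge 0$, $$\xi^n a=\sum_{i=0}^{n}P_{i,n}(\sigma,\delta)(a)\,\xi^i,$$ where $P_{i,n}(\sigma,\delta):A\to A$ is the sum of all $\binom{n}{i}$ noncommutative words of length $n$ in $\sigma$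 and $\delta$ containing $\sigma$ exactly $i$ times (e.g. $P_{3,4}=\delta\sigma^3+\sigma\delta\sigma^2+\sigma^2\delta\sigma+\sigma^3\delta$), and for $n\ge 1$, $$\xi^{-n}a=\sum_{i_1,\dots,i_n\ge 0}(-1)^{i_1+\cdots+i_n}\sigma^{-1}(\delta\sigma^{-1})^{i_n}\cdots\sigma^{-1}(\delta\sigma^{-1})^{i_1}(a)\,\xi^{-n-i_1-\cdots-i_n}.$$ The product of $\sum_n a_n\xi^n$ and $\sum_m b_m\xi^m$ is $\sum_{n,m}a_n(\xi^n b_m)\xi^m$, expanded with these formulas (each coefficient is a finite sum). *)

theory Defs
  imports Complex_Main
begin

section \<open>Algebras over the complex numbers\<close>

class scaleC =
  fixes scaleC :: "complex \<Rightarrow> 'a \<Rightarrow> 'a"  (infixr "*\<^sub>C" 75)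

class complex_vector = scaleC + ab_group_add +
  assumes scaleC_add_right: "c *\<^sub>C (x + y) = c *\<^sub>C x + c *\<^sub>C y"
    and scaleC_add_left: "(c + d) *\<^sub>C x = c *\<^sub>C x + d *\<^sub>C x"
    and scaleC_scaleC: "c *\<^sub>C d *\<^sub>C x = (c * d) *\<^sub>C x"
    and scaleC_one: "1 *\<^sub>C x = x"

text \<open>The class \<open>ring + monoid_mult\<close> is used instead of \<open>ring_1\<close> because the latter
  imposes \<open>0 \<noteq> 1\<close> and thereby excludes the zero algebra.\<close>

class complex_algebra = complex_vector + ring + monoid_mult +
  assumes mult_scaleC_left: "(c *\<^sub>C x) * y = c *\<^sub>C (x * y)"
    and mult_scaleC_right: "x * (c *\<^sub>C y) = c *\<^sub>C (x * y)"

interpretation complex_vector: vector_space "scaleC :: complex \<Rightarrow> 'a::complex_vector \<Rightarrow> 'a"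
  by unfold_locales (simp_all add: scaleC_add_right scaleC_add_left scaleC_scaleC scaleC_one)

abbreviation clinear :: "('a::complex_vector \<Rightarrow> 'b::complex_vector) \<Rightarrow> bool"
  where "clinear \<equiv> Vector_Spaces.linear scaleC scaleC"

abbreviation clinear_functional :: "('a::complex_vector \<Rightarrow> complex) \<Rightarrow> bool"
  where "clinear_functional \<equiv> Vector_Spaces.linear scaleC (*)"

definition algebra_automorphism :: "('a::complex_algebra \<Rightarrow> 'a) \<Rightarrow> bool"
  where "algebra_automorphism \<sigma> \<longleftrightarrow>
    clinear \<sigma> \<and> \<sigma> 1 = 1 \<and> (\<forall>a b. \<sigma> (a * b) = \<sigma> a * \<sigma> b) \<and> bij \<sigma>"

definition twisted_derivation :: "('a::complex_algebra \<Rightarrow> 'a) \<Rightarrow> ('a \<Rightarrow> 'a) \<Rightarrow> bool"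
  where "twisted_derivation \<sigma> \<delta> \<longleftrightarrow>
    clinear \<delta> \<and> (\<forall>a b. \<delta> (a * b) = \<delta> a * b + \<sigma> a * \<delta> b)"

definition twisted_trace :: "('a::complex_algebra \<Rightarrow> 'a) \<Rightarrow> ('a \<Rightarrow> complex) \<Rightarrow> bool"
  where "twisted_trace \<sigma> \<tau> \<longleftrightarrow>
    clinear_functional \<tau> \<and> (\<forall>a b. \<tau> (a * b) = \<tau> (\<sigma> b * a))"

text \<open>The product is an explicit argument here, because the product of twisted symbols depends
  on \<open>\<sigma>\<close> and \<open>\<delta>\<close> and so cannot be the class operation \<open>(*)\<close> of the type of symbols.\<close>

definition trace_for :: "('b::complex_vector \<Rightarrow> 'b \<Rightarrow> 'b) \<Rightarrow> ('b \<Rightarrow> complex) \<Rightarrow> bool"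
  where "trace_for mult \<rho> \<longleftrightarrow>
    clinear_functional \<rho> \<and> (\<forall>x y. \<rho> (mult x y) = \<rho> (mult y x))"


section \<open>Formal twisted pseudodifferential symbols\<close>

text \<open>The series \<open>\<Sum>n\<le>N. a\<^sub>n \<xi>\<^sup>n\<close> is represented by its coefficient function
  \<open>n \<mapsto> a\<^sub>n\<close>.\<close>

typedef (overloaded) 'a psi = "{f :: int \<Rightarrow> 'a::zero. \<exists>N. \<forall>n>N. f n = 0}"
  morphisms psi_coeff Abs_psi
  by (rule exI[of _ "\<lambda>_. 0"]) simp

setup_lifting type_definition_psi

instantiation psi :: (ab_group_add) ab_group_add
begin

lift_definition zero_psi :: "'a psi" is "\<lambda>_. 0"
  by simp

lift_definition plus_psi :: "'a psi \<Rightarrow> 'a psi \<Rightarrow> 'a psi" is "\<lambda>f g n. f n + g n"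
proof -
  fix f g :: "int \<Rightarrow> 'a"
  assume "\<exists>N. \<forall>n>N. f n = 0" "\<exists>N. \<forall>n>N. g n = 0"
  then obtain N M where "\<forall>n>N. f n = 0" "\<forall>n>M. g n = 0" by blast
  then show "\<exists>N. \<forall>n>N. f n + g n = 0" by (intro exI[of _ "max N M"]) simp
qed

lift_definition uminus_psi :: "'a psi \<Rightarrow> 'a psi" is "\<lambda>f n. - f n"
  by simp

lift_definition minus_psi :: "'a psi \<Rightarrow> 'a psi \<Rightarrow> 'a psi" is "\<lambda>f g n. f n - g n"
proof -
  fix f g :: "int \<Rightarrow> 'a"
  assume "\<exists>N. \<forall>n>N. f n = 0" "\<exists>N. \<forall>n>N. g n = 0"
  then obtain N M where "\<forall>n>N. f n = 0" "\<forall>n>M. g n = 0" by blast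
  then show "\<exists>N. \<forall>n>N. f n - g n = 0" by (intro exI[of _ "max N M"]) simp
qed

instance
  by standard (transfer; simp add: algebra_simps)+

end

instantiation psi :: (complex_vector) complex_vector
begin

lift_definition scaleC_psi :: "complex \<Rightarrow> 'a psi \<Rightarrow> 'a psi" is "\<lambda>c f n. c *\<^sub>C f n"
  by (metis complex_vector.scale_zero_right)

instance
  by standard
    (transfer; simp add: scaleC_add_right scaleC_add_left scaleC_scaleC scaleC_one)+

end

text \<open>A word of length \<open>n\<close> in \<open>\<sigma>\<close> and \<open>\<delta>\<close> is a Boolean list of length \<open>n\<close>, with \<open>True\<close>
  standing for \<open>\<sigma>\<close>; the head of the list is the outermost letter.\<close>

definition eval_word :: "('a \<Rightarrow> 'a) \<Rightarrow> ('a \<Rightarrow> 'a) \<Rightarrow> bool list \<Rightarrow> 'a \<Rightarrow> 'a"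
  where "eval_word \<sigma> \<delta> w = foldr (\<lambda>s. if s then \<sigma> else \<delta>) w"

definition word_sum ::
    "nat \<Rightarrow> nat \<Rightarrow> ('a::comm_monoid_add \<Rightarrow> 'a) \<Rightarrow> ('a \<Rightarrow> 'a) \<Rightarrow> 'a \<Rightarrow> 'a"
  where "word_sum i n \<sigma> \<delta> a =
    (\<Sum>w | length w = n \<and> count_list w True = i. eval_word \<sigma> \<delta> w a)"

text \<open>The list \<open>is\<close> is \<open>[i\<^sub>1, \<dots>, i\<^sub>n]\<close>; \<open>fold\<close> applies the factor for \<open>i\<^sub>1\<close> first, that is,
  innermost.\<close>

definition eval_inverse_word :: "('a \<Rightarrow> 'a) \<Rightarrow> ('a \<Rightarrow> 'a) \<Rightarrow> nat list \<Rightarrow> 'a \<Rightarrow> 'a"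
  where "eval_inverse_word \<sigma> \<delta> is = fold (\<lambda>i. inv \<sigma> \<circ> ((\<delta> \<circ> inv \<sigma>) ^^ i)) is"

definition inverse_word_sum ::
    "nat \<Rightarrow> nat \<Rightarrow> ('a::{ring,monoid_mult} \<Rightarrow> 'a) \<Rightarrow> ('a \<Rightarrow> 'a) \<Rightarrow> 'a \<Rightarrow> 'a"
  where "inverse_word_sum s n \<sigma> \<delta> a =
    (\<Sum>is | length is = n \<and> sum_list is = s. (- 1) ^ s * eval_inverse_word \<sigma> \<delta> is a)"

text \<open>The coefficient of \<open>\<xi>\<^sup>k\<close> in \<open>\<xi>\<^sup>n a\<close>. For \<open>n < 0\<close> it collects the terms with
  \<open>i\<^sub>1 + \<dots> + i\<^bsub>-n\<^esub> = n - k\<close>.\<close>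

definition xi_power_coeff ::
    "('a::{ring,monoid_mult} \<Rightarrow> 'a) \<Rightarrow> ('a \<Rightarrow> 'a) \<Rightarrow> int \<Rightarrow> 'a \<Rightarrow> int \<Rightarrow> 'a"
  where "xi_power_coeff \<sigma> \<delta> n a k =
    (if n \<ge> 0
     then (if 0 \<le> k \<and> k \<le> n then word_sum (nat k) (nat n) \<sigma> \<delta> a else 0)
     else (if k \<le> n then inverse_word_sum (nat (n - k)) (nat (- n)) \<sigma> \<delta> a else 0))"

text \<open>The coefficient of \<open>\<xi>\<^sup>k\<close> in the product of \<open>f = \<Sum>n. a\<^sub>n \<xi>\<^sup>n\<close> and \<open>g = \<Sum>m. b\<^sub>m \<xi>\<^sup>m\<close>
  is the sum over \<open>n\<close> and \<open>m\<close> of \<open>a\<^sub>n\<close> times the coefficient of \<open>\<xi>\<^bsup>k-m\<^esup>\<close> in \<open>\<xi>\<^sup>n b\<^sub>m\<close>.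
  The index set leaves out only terms that vanish (\<open>\<xi>\<^sup>n b\<^sub>m\<close> has order at most \<open>n\<close>), and it
  is finite by the next lemma.\<close>

definition psi_mult_index :: "(int \<Rightarrow> 'a::zero) \<Rightarrow> (int \<Rightarrow> 'a) \<Rightarrow> int \<Rightarrow> (int \<times> int) set"
  where "psi_mult_index f g k = {(n, m). f n \<noteq> 0 \<and> g m \<noteq> 0 \<and> k - m \<le> n}"

lemma finite_psi_mult_index:
  "finite (psi_mult_index (psi_coeff D) (psi_coeff E) k)"
proof -
  obtain N where N: "\<forall>n>N. psi_coeff D n = 0" using psi_coeff[of D] by blast
  obtain M where M: "\<forall>n>M. psi_coeff E n = 0" using psi_coeff[of E] by blast
  have "psi_mult_index (psi_coeff D) (psi_coeff E) k \<subseteq> {k - M..N} \<times> {k - N..M}"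
  proof
    fix p assume "p \<in> psi_mult_index (psi_coeff D) (psi_coeff E) k"
    then obtain n m where p: "p = (n, m)" "psi_coeff D n \<noteq> 0" "psi_coeff E m \<noteq> 0" "k - m \<le> n"
      by (auto simp: psi_mult_index_def)
    from p N have "n \<le> N" by (meson not_le)
    moreover from p M have "m \<le> M" by (meson not_le)
    ultimately show "p \<in> {k - M..N} \<times> {k - N..M}" using p by auto
  qed
  then show ?thesis by (rule finite_subset) simp
qed

lift_definition psi_mult ::
    "('a::{ring,monoid_mult} \<Rightarrow> 'a) \<Rightarrow> ('a \<Rightarrow> 'a) \<Rightarrow> 'a psi \<Rightarrow> 'a psi \<Rightarrow> 'a psi"
  is "\<lambda>\<sigma> \<delta> f g k. \<Sum>(n, m) \<in> psi_mult_index f g k. f n * xi_power_coeff \<sigma> \<delta> n (g m) (k - m)"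
proof -
  fix \<sigma> \<delta> :: "'a \<Rightarrow> 'a" and f g :: "int \<Rightarrow> 'a"
  assume "\<exists>N. \<forall>n>N. f n = 0" "\<exists>N. \<forall>n>N. g n = 0"
  then obtain N M where N: "\<forall>n>N. f n = 0" and M: "\<forall>n>M. g n = 0" by blast
  have "psi_mult_index f g k = {}" if "k > N + M" for k
  proof (rule ccontr)
    assume "psi_mult_index f g k \<noteq> {}"
    then obtain n m where p: "f n \<noteq> 0" "g m \<noteq> 0" "k - m \<le> n"
      by (auto simp: psi_mult_index_def)
    from p N have "n \<le> N" by (meson not_le)
    moreover from p M have "m \<le> M" by (meson not_le)
    ultimately show False using p(3) that by linarith
  qed
  then show "\<exists>N. \<forall>k>N. (\<Sum>(n, m) \<in> psi_mult_index f g k.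
      f n * xi_power_coeff \<sigma> \<delta> n (g m) (k - m)) = 0"
    by (intro exI[of _ "N + M"]) simp
qed

definition psi_res :: "('a::zero \<Rightarrow> complex) \<Rightarrow> 'a psi \<Rightarrow> complex"
  where "psi_res \<tau> D = \<tau> (psi_coeff D (- 1))"

end

theory Submission
  imports Defs
begin

text \<open>With respect to the pairing \<open>(a, b) \<mapsto> \<tau> (a * b)\<close>, the adjoint of \<open>\<sigma>\<close> is
  \<open>\<sigma>\<^sup>-\<^sup>1\<close> and, because \<open>\<tau> \<circ> \<delta> = 0\<close>, the adjoint of \<open>\<delta>\<close> is \<open>- \<delta> \<sigma>\<^sup>-\<^sup>1\<close>. Hence the adjoint of a
  word with \<open>k\<close> letters \<open>\<sigma>\<close> and \<open>s\<close> letters \<open>\<delta>\<close> is, up to one more \<open>\<sigma>\<^sup>-\<^sup>1\<close> that comes from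
  \<open>\<tau> (a * b) = \<tau> (b * \<sigma>\<^sup>-\<^sup>1 a)\<close>, one of the terms of the expansion of \<open>\<xi>\<^bsup>-k-1\<^esup> a\<close>. So the residues
  of \<open>a \<xi>\<^sup>n b \<xi>\<^sup>m\<close> and \<open>b \<xi>\<^sup>m a \<xi>\<^sup>n\<close> agree when \<open>n \<ge> 0 > m\<close>; if \<open>n\<close> and \<open>m\<close> have the same sign,
  both are \<open>0\<close>.\<close>

section \<open>Pascal-type recursions\<close>

lemma finite_bool_lists: "finite {w :: bool list. length w = n \<and> P w}"
  by (rule finite_subset[OF _ finite_lists_length_eq[of UNIV n]]) auto

lemma finite_nat_lists_sum: "finite {is :: nat list. length is = n \<and> sum_list is = s}"
  by (rule finite_subset[OF _ finite_lists_length_eq[of "{..s}" n]])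
    (auto simp: elem_le_sum_list in_set_conv_nth)

lemma word_sum_0_0 [simp]: "word_sum 0 0 \<sigma> \<delta> a = a"
proof -
  have "{w :: bool list. length w = 0 \<and> count_list w True = 0} = {[]}" by auto
  then show ?thesis by (simp add: word_sum_def eval_word_def)
qed

lemma word_sum_eq_0:
  assumes "n < k"
  shows "word_sum k n \<sigma> \<delta> a = 0"
proof -
  have "count_list w True \<noteq> k" if "length w = n" for w
    using assms that count_le_length[of w True] by linarith
  then have "{w. length w = n \<and> count_list w True = k} = {}" by blast
  then show ?thesis unfolding word_sum_def by (simp only: sum.empty)
qed

lemma word_sum_0_Suc:
  fixes \<sigma> \<delta> :: "'a::ab_group_add \<Rightarrow> 'a"
  assumes "additive \<delta>"
  shows "word_sum 0 (Suc n) \<sigma> \<delta> a = \<delta> (word_sum 0 n \<sigma> \<delta> a)"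
proof -
  have "{w. length w = Suc n \<and> count_list w True = 0} =
      Cons False ` {w. length w = n \<and> count_list w True = 0}"
    by (auto simp: length_Suc_conv split: if_splits)
  then show ?thesis
    by (simp add: word_sum_def additive.sum[OF assms] sum.reindex eval_word_def)
qed

text \<open>The words are split by their head, the outermost letter. Additivity is needed to pull
  that letter out of the sum.\<close>

lemma word_sum_Suc_Suc:
  fixes \<sigma> \<delta> :: "'a::ab_group_add \<Rightarrow> 'a"
  assumes "additive \<sigma>" "additive \<delta>"
  shows "word_sum (Suc k) (Suc n) \<sigma> \<delta> a =
    \<sigma> (word_sum k n \<sigma> \<delta> a) + \<delta> (word_sum (Suc k) n \<sigma> \<delta> a)"
proof -
  have "{w. length w = Suc n \<and> count_list w True = Suc k} =
      Cons True ` {w. length w = n \<and> count_list w True = k} \<union>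
      Cons False ` {w. length w = n \<and> count_list w True = Suc k}"
    by (auto simp: length_Suc_conv split: if_splits)
  moreover have "(Cons True ` {w. length w = n \<and> count_list w True = k}) \<inter>
      (Cons False ` {w. length w = n \<and> count_list w True = Suc k}) = {}"
    by auto
  ultimately show ?thesis
    by (simp add: word_sum_def additive.sum[OF assms(1)] additive.sum[OF assms(2)]
        sum.union_disjoint sum.reindex eval_word_def finite_bool_lists)
qed

lemma inverse_word_sum_0_0 [simp]: "inverse_word_sum 0 0 \<sigma> \<delta> a = a"
proof -
  have "{is :: nat list. length is = 0 \<and> sum_list is = 0} = {[]}" by auto
  then show ?thesis by (simp add: inverse_word_sum_def eval_inverse_word_def)
qed

lemma inverse_word_sum_Suc_0 [simp]: "inverse_word_sum (Suc s) 0 \<sigma> \<delta> a = 0"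
proof -
  have "{is :: nat list. length is = 0 \<and> sum_list is = Suc s} = {}" by auto
  then show ?thesis unfolding inverse_word_sum_def by (simp only: sum.empty)
qed

lemma inverse_word_sum_0_Suc:
  "inverse_word_sum 0 (Suc n) \<sigma> \<delta> a = inverse_word_sum 0 n \<sigma> \<delta> (inv \<sigma> a)"
proof -
  have "{is :: nat list. length is = Suc n \<and> sum_list is = 0} =
      Cons 0 ` {is. length is = n \<and> sum_list is = 0}"
    by (auto simp: length_Suc_conv simp del: sum_list_eq_0_iff)
  then show ?thesis
    by (simp add: inverse_word_sum_def sum.reindex eval_inverse_word_def
        del: sum_list_eq_0_iff)
qed

text \<open>Split by the innermost exponent \<open>i\<^sub>1\<close>: if it is 0, the first factor
  is just \<open>inv \<sigma>\<close>; otherwise one innermost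
  \<open>\<delta> \<circ> inv \<sigma>\<close> is peeled off at the cost of a sign. All peeling
  happens at the argument, so no additivity is required.\<close>

lemma inverse_word_sum_Suc_Suc:
  "inverse_word_sum (Suc s) (Suc n) \<sigma> \<delta> a =
    inverse_word_sum (Suc s) n \<sigma> \<delta> (inv \<sigma> a) - inverse_word_sum s (Suc n) \<sigma> \<delta> (\<delta> (inv \<sigma> a))"
proof -
  \<comment> \<open>\<open>inc\<close> raises \<open>i\<^sub>1\<close> by one; it maps the lists of
    sum \<open>s\<close> bijectively onto those of sum \<open>Suc s\<close> with positive
    head.\<close>
  define inc :: "nat list \<Rightarrow> nat list" where "inc is = Suc (hd is) # tl is" for "is"
  let ?A = "{is :: nat list. length is = n \<and> sum_list is = Suc s}"
  let ?B = "{is :: nat list. length is = Suc n \<and> sum_list is = s}"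
  have "is \<in> Cons 0 ` ?A \<union> inc ` ?B" if len_sum: "length is = Suc n" "sum_list is = Suc s" for "is"
  proof -
    obtain i js where ijs: "is = i # js" using len_sum by (auto simp: length_Suc_conv)
    show ?thesis
    proof (cases i)
      case 0
      then show ?thesis using len_sum ijs by auto
    next
      case (Suc j)
      then have "is = inc (j # js)" "j # js \<in> ?B" using len_sum ijs by (auto simp: inc_def)
      then show ?thesis by blast
    qed
  qed
  then have split: "{is. length is = Suc n \<and> sum_list is = Suc s} = Cons 0 ` ?A \<union> inc ` ?B"
    by (auto simp: inc_def length_Suc_conv)
  have disj: "Cons 0 ` ?A \<inter> inc ` ?B = {}"
    by (auto simp: inc_def)
  have inj: "inj_on inc ?B"
  proof (rule inj_onI)
    fix xs ys
    assume "xs \<in> ?B" "ys \<in> ?B" "inc xs = inc ys"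
    then have "xs \<noteq> []" "ys \<noteq> []" "hd xs = hd ys" "tl xs = tl ys"
      by (auto simp: inc_def)
    then show "xs = ys" by (simp add: list.expand)
  qed
  have eval_inc: "eval_inverse_word \<sigma> \<delta> (inc is) a = eval_inverse_word \<sigma> \<delta> is (\<delta> (inv \<sigma> a))"
    if "is \<in> ?B" for "is"
    using that by (auto simp: length_Suc_conv inc_def eval_inverse_word_def funpow_Suc_right
        simp del: funpow.simps)
  have "inverse_word_sum (Suc s) (Suc n) \<sigma> \<delta> a =
      (\<Sum>is\<in>Cons 0 ` ?A. (- 1) ^ Suc s * eval_inverse_word \<sigma> \<delta> is a) +
      (\<Sum>is\<in>inc ` ?B. (- 1) ^ Suc s * eval_inverse_word \<sigma> \<delta> is a)"
    unfolding inverse_word_sum_def split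
    by (rule sum.union_disjoint) (use disj finite_nat_lists_sum in auto)
  also have "(\<Sum>is\<in>Cons 0 ` ?A. (- 1) ^ Suc s * eval_inverse_word \<sigma> \<delta> is a) =
      inverse_word_sum (Suc s) n \<sigma> \<delta> (inv \<sigma> a)"
    by (simp add: inverse_word_sum_def sum.reindex eval_inverse_word_def)
  also have "(\<Sum>is\<in>inc ` ?B. (- 1) ^ Suc s * eval_inverse_word \<sigma> \<delta> is a) =
      - inverse_word_sum s (Suc n) \<sigma> \<delta> (\<delta> (inv \<sigma> a))"
    using eval_inc by (simp add: inverse_word_sum_def sum.reindex[OF inj] sum_negf)
  finally show ?thesis by simp
qed

section \<open>Adjoints with respect to a twisted trace\<close>

lemma linear_additive: "Vector_Spaces.linear s1 s2 f \<Longrightarrow> additive f"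
  by (simp add: Vector_Spaces.linear_iff additive_def)

lemma twisted_trace_additive: "twisted_trace \<sigma> \<tau> \<Longrightarrow> additive \<tau>"
  by (auto simp: twisted_trace_def intro: linear_additive)

text \<open>Take 1 as one of the two factors in the trace identity.\<close>

lemma twisted_trace_invariant: "twisted_trace \<sigma> \<tau> \<Longrightarrow> \<tau> (\<sigma> a) = \<tau> a"
  unfolding twisted_trace_def by (metis mult_1_left mult_1_right)

lemma algebra_automorphism_inv [simp]:
  "algebra_automorphism \<sigma> \<Longrightarrow> \<sigma> (inv \<sigma> a) = a"
  by (simp add: algebra_automorphism_def bij_is_surj surj_f_inv_f)

lemma twisted_trace_swap:
  assumes "algebra_automorphism \<sigma>" "twisted_trace \<sigma> \<tau>"
  shows "\<tau> (a * b) = \<tau> (b * inv \<sigma> a)"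
proof -
  have "\<tau> (b * inv \<sigma> a) = \<tau> (\<sigma> (inv \<sigma> a) * b)"
    using assms(2) unfolding twisted_trace_def by blast
  then show ?thesis using assms(1) by simp
qed

lemma twisted_trace_adjoint_automorphism:
  assumes "algebra_automorphism \<sigma>" "twisted_trace \<sigma> \<tau>"
  shows "\<tau> (a * \<sigma> b) = \<tau> (inv \<sigma> a * b)"
proof -
  have "a * \<sigma> b = \<sigma> (inv \<sigma> a * b)"
    using assms(1) by (metis algebra_automorphism_def algebra_automorphism_inv)
  then show ?thesis using assms(2) by (simp add: twisted_trace_invariant)
qed

text \<open>Integration by parts: the twisted Leibniz rule is applied to
  \<open>inv \<sigma> a * b\<close>, where the twist turns \<open>inv \<sigma> a\<close> back into
  \<open>a\<close>.\<close>

lemma twisted_trace_adjoint_derivation: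
  assumes "algebra_automorphism \<sigma>" "twisted_derivation \<sigma> \<delta>" "twisted_trace \<sigma> \<tau>"
    and "\<tau> \<circ> \<delta> = (\<lambda>_. 0)"
  shows "\<tau> (a * \<delta> b) = - \<tau> (\<delta> (inv \<sigma> a) * b)"
proof -
  have "0 = \<tau> (\<delta> (inv \<sigma> a * b))" using assms(4) by (metis comp_apply)
  also have "\<dots> = \<tau> (\<delta> (inv \<sigma> a) * b + a * \<delta> b)"
    using assms(1,2) by (simp add: twisted_derivation_def)
  finally show ?thesis
    using assms(3)
    by (simp add: additive.add[OF twisted_trace_additive] add_eq_0_iff)
qed

text \<open>Induction on the length with \<open>a\<close> arbitrary: the outermost letter, moved
  across the pairing, acts on \<open>a\<close> before everything else. One recursion peels off the
  outermost letter and the other the innermost factor, so they match after this move. The base case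
  supplies the extra \<open>inv \<sigma>\<close>, hence \<open>Suc k\<close>.\<close>

lemma twisted_trace_word_sum:
  assumes \<sigma>: "algebra_automorphism \<sigma>" and \<delta>: "twisted_derivation \<sigma> \<delta>"
    and \<tau>: "twisted_trace \<sigma> \<tau>" and \<tau>\<delta>: "\<tau> \<circ> \<delta> = (\<lambda>_. 0)"
    and "k \<le> n"
  shows "\<tau> (a * word_sum k n \<sigma> \<delta> b) = \<tau> (b * inverse_word_sum (n - k) (Suc k) \<sigma> \<delta> a)"
  using \<open>k \<le> n\<close>
proof (induction n arbitrary: k a)
  case 0
  then show ?case
    using twisted_trace_swap[OF \<sigma> \<tau>] by (simp add: inverse_word_sum_0_Suc)
next
  case (Suc n)
  have add: "additive \<sigma>" "additive \<delta>"
    using \<sigma> \<delta> by (auto simp: algebra_automorphism_def twisted_derivation_def intro: linear_additive)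
  note adjoint_\<sigma> = twisted_trace_adjoint_automorphism[OF \<sigma> \<tau>]
  note adjoint_\<delta> = twisted_trace_adjoint_derivation[OF \<sigma> \<delta> \<tau> \<tau>\<delta>]
  note \<tau>_simps = additive.add[OF twisted_trace_additive[OF \<tau>]]
    additive.diff[OF twisted_trace_additive[OF \<tau>]]
    additive.minus[OF twisted_trace_additive[OF \<tau>]]
    additive.zero[OF twisted_trace_additive[OF \<tau>]]
  show ?case
  proof (cases k)
    case 0
    then show ?thesis
      using Suc.IH[of 0] add
      by (simp add: word_sum_0_Suc inverse_word_sum_Suc_Suc adjoint_\<delta> \<tau>_simps)
  next
    case (Suc j)
    show ?thesis
    \<comment> \<open>For \<open>k = Suc n\<close>, a word with outermost \<delta> would need more
      letters \<sigma> than it has places left, so that summand vanishes; the induction hypothesis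
      for \<open>k\<close> would not apply to it.\<close>
    proof (cases "j = n")
      case True
      then show ?thesis
        using Suc.IH[of j] Suc add
        by (simp add: word_sum_Suc_Suc word_sum_eq_0 additive.zero inverse_word_sum_0_Suc
            adjoint_\<sigma>)
    next
      case False
      then have "Suc n - k = Suc (n - k)" "n - j = Suc (n - k)" "j \<le> n" "k \<le> n"
        using Suc Suc.prems by auto
      then show ?thesis
        using Suc.IH[of j] Suc.IH[of k] Suc add
        by (simp add: word_sum_Suc_Suc inverse_word_sum_Suc_Suc[of _ "Suc j"] adjoint_\<sigma> adjoint_\<delta>
            distrib_left right_diff_distrib \<tau>_simps)
    qed
  qed
qed

section \<open>The residue\<close>

lemma twisted_trace_xi_power_coeff:
  assumes \<sigma>: "algebra_automorphism \<sigma>" and \<delta>: "twisted_derivation \<sigma> \<delta>"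
    and \<tau>: "twisted_trace \<sigma> \<tau>" and \<tau>\<delta>: "\<tau> \<circ> \<delta> = (\<lambda>_. 0)"
  shows "\<tau> (a * xi_power_coeff \<sigma> \<delta> n b (- 1 - m)) = \<tau> (b * xi_power_coeff \<sigma> \<delta> m a (- 1 - n))"
proof -
  have mixed: "\<tau> (a * xi_power_coeff \<sigma> \<delta> n b (- 1 - m)) =
      \<tau> (b * xi_power_coeff \<sigma> \<delta> m a (- 1 - n))"
    if nm: "n \<ge> 0" "m < 0" for a b n m
  proof (cases "- 1 - m \<le> n")
    case True
    \<comment> \<open>With \<open>- 1 - m\<close> letters \<sigma> in a word of length
      \<open>n\<close>, the number of letters \<delta> is \<open>n + m + 1\<close>, which is also
      the sum of the exponents on the other side.\<close>
    have "nat (m - (- 1 - n)) = nat n - nat (- 1 - m)" "nat (- m) = Suc (nat (- 1 - m))"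
      "nat (- 1 - m) \<le> nat n"
      using True nm by linarith+
    then show ?thesis
      using True nm twisted_trace_word_sum[OF \<sigma> \<delta> \<tau> \<tau>\<delta>, of "nat (- 1 - m)" "nat n" a b]
      by (simp add: xi_power_coeff_def)
  next
    case False
    \<comment> \<open>\<open>- 1 - m > n\<close> is equivalent to \<open>- 1 - n > m\<close>, so
      both coefficients lie above the order and vanish together.\<close>
    then show ?thesis using nm by (simp add: xi_power_coeff_def)
  qed
  consider "n \<ge> 0 \<and> m < 0" | "m \<ge> 0 \<and> n < 0" | "(n \<ge> 0 \<and> m \<ge> 0) \<or> (n < 0 \<and> m < 0)"
    by linarith
  then show ?thesis
  proof cases
    case 1
    then show ?thesis using mixed by blast
  next
    case 2
    then show ?thesis using mixed[of m n b a] by simp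
  next
    case 3
    \<comment> \<open>For \<open>n, m \<ge> 0\<close> negative powers are requested of polynomials
      in \<xi>; for \<open>n, m < 0\<close> nonnegative powers of series of negative order.\<close>
    then show ?thesis by (auto simp: xi_power_coeff_def)
  qed
qed

lemma psi_res_mult:
  assumes "additive \<tau>"
  shows "psi_res \<tau> (psi_mult \<sigma> \<delta> D E) =
    (\<Sum>(n, m)\<in>psi_mult_index (psi_coeff D) (psi_coeff E) (- 1).
      \<tau> (psi_coeff D n * xi_power_coeff \<sigma> \<delta> n (psi_coeff E m) (- 1 - m)))"
  by (simp add: psi_res_def psi_mult.rep_eq additive.sum[OF assms] case_prod_unfold)

lemma psi_res_linear:
  assumes "clinear_functional \<tau>"
  shows "clinear_functional (psi_res \<tau>)"
  using assms
  by (simp add: Vector_Spaces.linear_iff psi_res_def plus_psi.rep_eq scaleC_psi.rep_eq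
      complex_vector.vector_space_axioms)

theorem theorem3p3:
  fixes \<sigma> \<delta> :: "'a::complex_algebra \<Rightarrow> 'a" and \<tau> :: "'a \<Rightarrow> complex"
  assumes "algebra_automorphism \<sigma>"
    and "twisted_derivation \<sigma> \<delta>"
    and "twisted_trace \<sigma> \<tau>"
    and "\<tau> \<circ> \<delta> = (\<lambda>_. 0)"
  shows "trace_for (psi_mult \<sigma> \<delta>) (psi_res \<tau>)"
  unfolding trace_for_def
proof (intro conjI allI)
  show "clinear_functional (psi_res \<tau>)"
    using assms(3) by (intro psi_res_linear) (simp add: twisted_trace_def)
next
  fix D E :: "'a psi"
  have "psi_res \<tau> (psi_mult \<sigma> \<delta> D E) =
    (\<Sum>(n, m)\<in>psi_mult_index (psi_coeff D) (psi_coeff E) (- 1).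
      \<tau> (psi_coeff E m * xi_power_coeff \<sigma> \<delta> m (psi_coeff D n) (- 1 - n)))"
    unfolding psi_res_mult[OF twisted_trace_additive[OF assms(3)]]
    by (intro sum.cong refl) (auto simp: twisted_trace_xi_power_coeff[OF assms])
  also have "\<dots> = (\<Sum>(m, n)\<in>psi_mult_index (psi_coeff E) (psi_coeff D) (- 1).
      \<tau> (psi_coeff E m * xi_power_coeff \<sigma> \<delta> m (psi_coeff D n) (- 1 - n)))"
    \<comment> \<open>The index condition \<open>- 1 - m \<le> n\<close> is symmetric in
      \<open>n\<close> and \<open>m\<close>.\<close>
    by (rule sum.reindex_bij_witness[where i = prod.swap and j = prod.swap])
      (auto simp: psi_mult_index_def)
  also have "\<dots> = psi_res \<tau> (psi_mult \<sigma> \<delta> E D)"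
    unfolding psi_res_mult[OF twisted_trace_additive[OF assms(3)]] ..
  finally show "psi_res \<tau> (psi_mult \<sigma> \<delta> D E) = psi_res \<tau> (psi_mult \<sigma> \<delta> E D)" .
qed

end
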